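(* Let $\Pi_q$ be an arbitrary projective plane of order $q>133$. Then \[\overline{\chi}_b(\Pi_q)\ \ge\ \frac{q^2+q-16}{10}.\]
   Context: For a hypergraph with vertex set $V$ and edge set $E$, a strict $N$-coloring is a partition of $V$ into exactly $N$ nonempty color classes. An edge is rainbow if no two of its vertices have the same color. A coloring is proper (rainbow-free) if no edge is rainbow, and balanced if the sizes of any two color classes differ by at most one. The balanced upper chromatic number $\overline{\chi}_b$ of a hypergraph is the largest $N$ such that it admits a proper strict balanced $N$-coloring. A projective plane is regarded as the hypergraph whose vertices are the points and whose edges are the lines. *)

theory Defs
  imports Complex_Main "HOL-Library.Disjoint_Sets"
begin

text \<open>
  A hypergraph is given by its finite vertex set \<open>V\<close> and its set of edges \<open>E\<close>, which are subsets
  of \<open>V\<close>.  A coloring is identified with the set \<open>C\<close> of its color classes.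
\<close>

locale hypergraph =
  fixes V :: "'a set" and E :: "'a set set"
  assumes finite_vertices: "finite V"
    and edge_subset: "e \<in> E \<Longrightarrow> e \<subseteq> V"

text \<open>The color classes are nonempty by definition of \<^const>\<open>partition_on\<close>.\<close>

definition strict_coloring :: "'a set \<Rightarrow> nat \<Rightarrow> 'a set set \<Rightarrow> bool" where
  "strict_coloring V N C \<longleftrightarrow> partition_on V C \<and> card C = N"

definition rainbow :: "'a set set \<Rightarrow> 'a set \<Rightarrow> bool" where
  "rainbow C e \<longleftrightarrow> (\<forall>x\<in>e. \<forall>y\<in>e. x \<noteq> y \<longrightarrow> \<not> (\<exists>A\<in>C. x \<in> A \<and> y \<in> A))"

definition proper_coloring :: "'a set set \<Rightarrow> 'a set set \<Rightarrow> bool" where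
  "proper_coloring E C \<longleftrightarrow> (\<forall>e\<in>E. \<not> rainbow C e)"

definition balanced :: "'a set set \<Rightarrow> bool" where
  "balanced C \<longleftrightarrow> (\<forall>A\<in>C. \<forall>B\<in>C. card A \<le> card B + 1)"

text \<open>
  On a finite nonempty vertex set, the number of classes is bounded by the number of vertices, so
  the greatest element below exists as soon as some proper balanced coloring exists; the coloring
  with a single class is one if every edge has at least two vertices.
\<close>

definition balanced_upper_chromatic_number :: "'a set \<Rightarrow> 'a set set \<Rightarrow> nat" where
  "balanced_upper_chromatic_number V E =
     (GREATEST N. \<exists>C. strict_coloring V N C \<and> proper_coloring E C \<and> balanced C)"

locale projective_plane = hypergraph V E for V :: "'a set" and E :: "'a set set" +
  assumes unique_line: "\<lbrakk>x \<in> V; y \<in> V; x \<noteq> y\<rbrakk> \<Longrightarrow> \<exists>!l. l \<in> E \<and> x \<in> l \<and> y \<in> l"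
    and unique_point: "\<lbrakk>l \<in> E; m \<in> E; l \<noteq> m\<rbrakk> \<Longrightarrow> \<exists>!x. x \<in> V \<and> x \<in> l \<and> x \<in> m"
    and quadrangle: "\<exists>Q. Q \<subseteq> V \<and> card Q = 4 \<and> (\<forall>l\<in>E. card (Q \<inter> l) \<le> 2)"

locale projective_plane_of_order = projective_plane V E
  for V :: "'a set" and E :: "'a set set" and q :: nat +
  assumes line_size: "l \<in> E \<Longrightarrow> card l = q + 1"

end

theory Submission
  imports Defs "HOL-Analysis.Convex"
begin

text \<open>
  Fix a point \<open>P\<close> and group the other points into the \<open>q + 1\<close> rays through \<open>P\<close>; a line avoiding \<open>P\<close>
  meets each ray in one point.  About \<open>7q/10\<close> of the rays are colored in batches of ten, with \<open>q\<close>
  classes of size \<open>10\<close> per batch.  Choosing cyclic shifts of the rays one after the other by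
  averaging, at most \<open>q\<^sup>2 exp (-36j/q) \<le> q\<^sup>2/9\<close> of the lines avoiding \<open>P\<close> are rainbow on the \<open>j\<close>
  batches.  These lines, together with the remaining lines through \<open>P\<close>, are given disjoint pairs of
  points on the remaining rays by Hall's theorem, whose condition follows from a variance
  (Cauchy-Schwarz) estimate of incidences.  The points of the remaining rays are then cut into
  classes of size \<open>10\<close> that respect the pairs, and the at most nine leftover points are
  added to distinct classes.
\<close>

section \<open>Colorings given by functions\<close>

text \<open>Surjectivity onto \<open>K\<close> makes every fibre nonempty, so distinct colors give
  distinct classes and there are \<open>card K\<close> of them; two sizes \<open>s\<close> and
  \<open>Suc s\<close> are just what balance tolerates.\<close>

lemma (in hypergraph) balanced_upper_chromatic_number_ge:
  fixes f :: "'a \<Rightarrow> 'c"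
  assumes img: "f ` V = K"
    and sizes: "\<And>c. c \<in> K \<Longrightarrow> card {x \<in> V. f x = c} \<in> {s, Suc s}"
    and edges: "\<And>e. e \<in> E \<Longrightarrow> \<exists>x\<in>e. \<exists>y\<in>e. x \<noteq> y \<and> f x = f y"
  shows "card K \<le> balanced_upper_chromatic_number V E"
proof -
  define fib where "fib c = {x \<in> V. f x = c}" for c
  have part: "partition_on V (fib ` K)"
    unfolding partition_on_def disjoint_def using img by (auto simp: fib_def)
  have "inj_on fib K"
    using img by (auto simp: fib_def inj_on_def) 
  then have card: "card (fib ` K) = card K" by (rule card_image)
  have "strict_coloring V (card K) (fib ` K)"
    using part card by (simp add: strict_coloring_def)
  moreover have "proper_coloring E (fib ` K)"
    unfolding proper_coloring_def rainbow_def
  proof (intro ballI notI)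
    fix e assume e: "e \<in> E"
      and r: "\<forall>x\<in>e. \<forall>y\<in>e. x \<noteq> y \<longrightarrow> \<not> (\<exists>A\<in>fib ` K. x \<in> A \<and> y \<in> A)"
    obtain x y where "x \<in> e" "y \<in> e" "x \<noteq> y" "f x = f y" using edges[OF e] by blast
    moreover have "x \<in> V" "y \<in> V" using edge_subset[OF e] calculation by auto
    ultimately show False using r img by (auto simp: fib_def)
  qed
  moreover have "balanced (fib ` K)"
    unfolding balanced_def fib_def
  proof safe
    fix c d assume "c \<in> K" "d \<in> K"
    with sizes[of c] sizes[of d] show "card {x \<in> V. f x = c} \<le> card {x \<in> V. f x = d} + 1" by auto
  qed
  ultimately have ex: "\<exists>C. strict_coloring V (card K) C \<and> proper_coloring E C \<and> balanced C"
    by blast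
  \<comment> \<open>\<open>GREATEST\<close> dominates a witness only if the admissible
    \<open>N\<close> are bounded; classes are subsets of \<open>V\<close>, which gives this crude
    bound.\<close>
  have "N \<le> card (Pow V)" if "\<exists>C. strict_coloring V N C \<and> proper_coloring E C \<and> balanced C" (is "?P N") for N
  proof -
    obtain C where "partition_on V C" "card C = N"
      using \<open>?P N\<close> unfolding strict_coloring_def by blast
    then have "C \<subseteq> Pow V" by (auto simp: partition_on_def)
    with \<open>card C = N\<close> show ?thesis using finite_vertices by (auto intro: card_mono)
  qed
  then show ?thesis
    unfolding balanced_upper_chromatic_number_def using ex by (intro Greatest_le_nat) auto
qed

section \<open>Hall's theorem\<close>

text \<open>Halmos-Vaughan induction on the size of \<open>I\<close>. If some nonempty proper
  subfamily \<open>J\<close> is tight, it is matched first and the rest is matched outside its union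
  \<open>X\<close>. Otherwise every nonempty proper subfamily has an element to spare, and any
  representative of a single index can be fixed.\<close>

lemma hall_marriage:
  assumes "finite I" and "\<And>i. i \<in> I \<Longrightarrow> finite (S i)"
    and "\<And>J. J \<subseteq> I \<Longrightarrow> card J \<le> card (\<Union>i\<in>J. S i)"
  shows "\<exists>r. (\<forall>i\<in>I. r i \<in> S i) \<and> inj_on r I"
  using assms
proof (induction "card I" arbitrary: I S rule: less_induct)
  case less
  note fin = less.prems(1) and finS = less.prems(2) and hall = less.prems(3)
  show ?case
  proof (cases "\<exists>J. J \<subset> I \<and> J \<noteq> {} \<and> card (\<Union>i\<in>J. S i) \<le> card J")
    case True
    then obtain J where J: "J \<subset> I" "J \<noteq> {}" "card (\<Union>i\<in>J. S i) \<le> card J" by blast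
    define X where "X = (\<Union>i\<in>J. S i)"
    have finJ: "finite J" using J fin finite_subset by blast
    have finX: "finite X" unfolding X_def using J finS finJ by auto
    have "card J < card I" using J fin psubset_card_mono by blast
    then have "\<exists>r. (\<forall>i\<in>J. r i \<in> S i) \<and> inj_on r J"
      using J finS hall finJ by (intro less.hyps) (auto 4 4)
    then obtain r1 where r1: "\<forall>i\<in>J. r1 i \<in> S i" "inj_on r1 J" by blast
    have "card (I - J) < card I"
      using J fin by (intro psubset_card_mono) auto
    moreover have "card L \<le> card (\<Union>i\<in>L. S i - X)" if L: "L \<subseteq> I - J" for L
    proof -
      have finL: "finite L" using L fin finite_subset by blast
      \<comment> \<open>The condition for \<open>L \<union> J\<close>, less the at most
        \<open>card J\<close> elements of \<open>X\<close>, is the condition for \<open>L\<close>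
        outside \<open>X\<close>.\<close>
      have "card L + card J = card (L \<union> J)"
        using L finL finJ by (subst card_Un_disjoint) auto
      also have "\<dots> \<le> card (\<Union>i\<in>L \<union> J. S i)" using L J by (intro hall) auto
      also have "(\<Union>i\<in>L \<union> J. S i) = (\<Union>i\<in>L. S i - X) \<union> X" by (auto simp: X_def)
      also have "card \<dots> \<le> card (\<Union>i\<in>L. S i - X) + card X" by (rule card_Un_le)
      finally show ?thesis using J(3) by (simp add: X_def)
    qed
    ultimately have "\<exists>r. (\<forall>i\<in>I - J. r i \<in> S i - X) \<and> inj_on r (I - J)"
      using fin finS by (intro less.hyps) auto
    then obtain r2 where r2: "\<forall>i\<in>I - J. r2 i \<in> S i - X" "inj_on r2 (I - J)" by blast
    define r where "r i = (if i \<in> J then r1 i else r2 i)" for i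
    have "r i \<in> S i" if "i \<in> I" for i using r1 r2 that by (auto simp: r_def)
    moreover have "inj_on r I"
    proof -
      have "inj_on r J" using r1(2) by (simp add: r_def inj_on_def)
      moreover have "inj_on r (I - J)" using r2(2) by (simp add: r_def inj_on_def)
      moreover have "r ` J \<inter> r ` (I - J) = {}"
        using r1(1) r2(1) by (fastforce simp: r_def X_def)
      ultimately have "inj_on r (J \<union> (I - J))" unfolding inj_on_Un by auto
      moreover have "J \<union> (I - J) = I" using J(1) by blast
      ultimately show ?thesis by simp
    qed
    ultimately show ?thesis by blast
  next
    case False
    show ?thesis
    proof (cases "I = {}")
      case True then show ?thesis by auto
    next
      case ne: False
      then obtain i where i: "i \<in> I" by blast
      have "card {i} \<le> card (\<Union>i\<in>{i}. S i)" using i by (intro hall) auto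
      then have "S i \<noteq> {}" by auto
      then obtain x where x: "x \<in> S i" by blast
      have "card (I - {i}) < card I" using i fin by (simp add: card_gt_0_iff ne)
      moreover have "card L \<le> card (\<Union>j\<in>L. S j - {x})" if L: "L \<subseteq> I - {i}" for L
      proof (cases "L = {}")
        case Lne: False
        have "L \<subset> I" using L i by auto
        \<comment> \<open>Without tight subfamilies the inequality is strict, which pays for the
          removal of \<open>x\<close>.\<close>
        then have "card L < card (\<Union>j\<in>L. S j)" using False Lne by (auto simp: not_le)
        also have "(\<Union>j\<in>L. S j) \<subseteq> insert x (\<Union>j\<in>L. S j - {x})" by auto
        then have "card (\<Union>j\<in>L. S j) \<le> card (insert x (\<Union>j\<in>L. S j - {x}))"
          using L fin finS by (intro card_mono) (auto intro!: finite_UN_I[OF finite_subset[OF _ fin]])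
        also have "\<dots> \<le> Suc (card (\<Union>j\<in>L. S j - {x}))" by (rule card_insert_le_m1) auto
        finally show ?thesis by simp
      qed auto
      ultimately have "\<exists>r. (\<forall>j\<in>I - {i}. r j \<in> S j - {x}) \<and> inj_on r (I - {i})"
        using fin finS by (intro less.hyps) auto
      then obtain r where r: "\<forall>j\<in>I - {i}. r j \<in> S j - {x}" "inj_on r (I - {i})" by blast
      have "inj_on (r(i := x)) I"
        using r i by (auto simp: inj_on_def)
      moreover have "\<forall>j\<in>I. (r(i := x)) j \<in> S j" using r x by auto
      ultimately show ?thesis by blast
    qed
  qed
qed

section \<open>Coloring batches of rays by averaging\<close>

text \<open>
  The color of the point at position \<open>p\<close> of the \<open>i\<close>-th ray of a batch.  The last two positions share
  a color on each ray, so that the ten lines carrying the rays are not rainbow either; to keep the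
  class size \<open>10\<close>, the two exceptional classes are spread over five rays each.
\<close>

definition batch_color :: "nat \<Rightarrow> nat \<Rightarrow> nat \<Rightarrow> nat" where
  "batch_color q i p = (if p < q - 2 then p else if i < 5 then q - 2 else q - 1)"

lemma batch_color_less: "2 \<le> q \<Longrightarrow> batch_color q i p < q"
  by (auto simp: batch_color_def)

lemma card_batch_color_fibre:
  assumes "2 \<le> q" "c < q"
  shows "card {(i, p) \<in> {..<10} \<times> {..<q}. batch_color q i p = c} = 10"
proof -
  have "{(i, p) \<in> {..<10} \<times> {..<q}. batch_color q i p = c} =
    (if c < q - 2 then {..<10} \<times> {c}
     else if c = q - 2 then {..<5} \<times> {q - 2, q - 1} else {5..<10} \<times> {q - 2, q - 1})"
    using assms by (auto simp: batch_color_def split: if_splits)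
  then show ?thesis using assms by auto
qed

text \<open>
  A color seen before recurs at the position with its own number, except possibly \<open>q - 2\<close>.
\<close>

lemma card_batch_color_avoiding:
  fixes p :: "nat \<Rightarrow> nat"
  assumes q: "2 \<le> q"
    and inj: "inj_on (\<lambda>t. batch_color q t (p t)) {..<i}"
  shows "card {x \<in> {..<q}. batch_color q i x \<notin> (\<lambda>t. batch_color q t (p t)) ` {..<i}} \<le> q - (i - 1)"
proof -
  define S where "S = (\<lambda>t. batch_color q t (p t)) ` {..<i}"
  have "card S = i" unfolding S_def using inj by (simp add: card_image)
  have "S \<subseteq> {..<q}" using q by (auto simp: S_def batch_color_less)
  \<comment> \<open>The color \<open>q - 1\<close> is seen only if a ray of index at least five came
    before, and then ray \<open>i\<close> uses it as well. The color \<open>q - 2\<close> may be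
    absent from ray \<open>i\<close>; excluding it costs the one in \<open>i - 1\<close>.\<close>
  have fixed: "batch_color q i c = c" if "c \<in> S - {q - 2}" for c
    using that q by (auto simp: S_def batch_color_def split: if_splits)
  have "i - 1 \<le> card (S - {q - 2})"
    using \<open>card S = i\<close> diff_card_le_card_Diff[of "{q - 2}" S] by simp
  moreover have "{x \<in> {..<q}. batch_color q i x \<notin> S} \<subseteq> {..<q} - (S - {q - 2})"
    using fixed by fastforce
  then have "card {x \<in> {..<q}. batch_color q i x \<notin> S} \<le> card ({..<q} - (S - {q - 2}))"
    by (intro card_mono) auto
  moreover have "card ({..<q} - (S - {q - 2})) = q - card (S - {q - 2})"
    using \<open>S \<subseteq> {..<q}\<close> by (subst card_Diff_subset) (auto intro: finite_subset)
  ultimately show ?thesis unfolding S_def by linarith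
qed

lemma bij_betw_add_mod:
  fixes a q :: nat
  assumes "0 < q"
  shows "bij_betw (\<lambda>s. (a + s) mod q) {..<q} {..<q}"
proof -
  have "inj_on (\<lambda>s. (a + s) mod q) {..<q}"
  proof (rule inj_onI)
    fix s t assume st: "s \<in> {..<q}" "t \<in> {..<q}" and "(a + s) mod q = (a + t) mod q"
    then have "(int a + int s) mod int q = (int a + int t) mod int q"
      by (metis of_nat_add zmod_int)
    then have "int s mod int q = int t mod int q"
      by (metis mod_diff_left_eq add_diff_cancel_left')
    then show "s = t" using st by simp
  qed
  moreover have "(\<lambda>s. (a + s) mod q) ` {..<q} \<subseteq> {..<q}" using assms by auto
  ultimately show ?thesis
    by (simp add: bij_betw_def endo_inj_surj)
qed

text \<open>\<open>p t\<close> stands for the position where a line meets ray \<open>t\<close>.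
  Batches will use disjoint palettes, so only indices with equal quotient by ten can
  collide.\<close>

definition rainbow_before :: "nat \<Rightarrow> (nat \<Rightarrow> nat) \<Rightarrow> nat \<Rightarrow> bool" where
  "rainbow_before q p n \<longleftrightarrow> (\<forall>t<n. \<forall>u<t. t div 10 = u div 10 \<longrightarrow>
     batch_color q (t mod 10) (p t) \<noteq> batch_color q (u mod 10) (p u))"

text \<open>The form in which the averaging adds one coordinate: earlier rays in the batch of
  \<open>n\<close> are \<open>10 * (n div 10) + i\<close> with \<open>i < n mod 10\<close>. At the
  start of a batch there are none.\<close>

lemma rainbow_before_Suc:
  "rainbow_before q p (Suc n) \<longleftrightarrow> rainbow_before q p n \<and>
    batch_color q (n mod 10) (p n) \<notin>
      (\<lambda>i. batch_color q i (p (10 * (n div 10) + i))) ` {..<n mod 10}"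
proof -
  define D where "D = 10 * (n div 10)"
  have n: "n = D + n mod 10" by (simp add: D_def)
  have "(\<forall>u<n. n div 10 = u div 10 \<longrightarrow>
       batch_color q (n mod 10) (p n) \<noteq> batch_color q (u mod 10) (p u)) \<longleftrightarrow>
     (\<forall>i<n mod 10. batch_color q (n mod 10) (p n) \<noteq> batch_color q i (p (D + i)))"
    (is "?L \<longleftrightarrow> ?R")
  proof
    assume L: ?L
    show ?R
    proof (intro allI impI)
      fix i assume i: "i < n mod 10"
      then have "i < 10" by (meson less_trans mod_less_divisor zero_less_numeral)
      then have "(D + i) div 10 = n div 10" "(D + i) mod 10 = i" by (auto simp: D_def)
      moreover have "D + i < n" using i n by linarith
      ultimately
      show "batch_color q (n mod 10) (p n) \<noteq> batch_color q i (p (D + i))"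
        using L by metis
    qed
  next
    assume R: ?R
    show ?L
    proof (intro allI impI)
      fix u assume u: "u < n" "n div 10 = u div 10"
      then have "u = D + u mod 10" by (simp add: D_def)
      moreover have "u mod 10 < n mod 10" using u n calculation by linarith
      ultimately show "batch_color q (n mod 10) (p n) \<noteq> batch_color q (u mod 10) (p u)"
        using R by metis
    qed
  qed
  then show ?thesis unfolding rainbow_before_def D_def by (auto simp: less_Suc_eq)
qed

lemma rainbow_before_inj_on:
  assumes "rainbow_before q p n"
  shows "inj_on (\<lambda>i. batch_color q i (p (10 * (n div 10) + i))) {..<n mod 10}"
proof (rule linorder_inj_onI')
  fix i j assume ij: "i \<in> {..<n mod 10}" "j \<in> {..<n mod 10}" "i < j"
  define t u where "t = 10 * (n div 10) + j" and "u = 10 * (n div 10) + i"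
  have "j < 10" using ij by (meson less_trans mod_less_divisor zero_less_numeral lessThan_iff)
  then have "u < t" "t div 10 = u div 10" "t mod 10 = j" "u mod 10 = i"
    using ij unfolding t_def u_def by auto
  moreover have "n = 10 * (n div 10) + n mod 10" by simp
  then have "t < n" using ij unfolding t_def by (metis lessThan_iff nat_add_left_cancel_less)
  ultimately show "batch_color q i (p (10 * (n div 10) + i)) \<noteq> batch_color q j (p (10 * (n div 10) + j))"
    using assms unfolding rainbow_before_def by (metis t_def u_def)
qed

text \<open>Averaging over the shift \<open>s n\<close> of the \<open>n\<close>-th coordinate gives the factor of the product.\<close>

lemma exists_shifts_few_rainbow:
  fixes X :: "'l \<Rightarrow> nat \<Rightarrow> nat"
  assumes L: "finite L" and q: "10 \<le> q"
  shows "\<exists>s. real (card {l \<in> L. rainbow_before q (\<lambda>t. (X l t + s t) mod q) n})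
    \<le> card L * (\<Prod>t<n. 1 - real (t mod 10 - 1) / q)"
proof (induction n)
  case 0
  then show ?case by (simp add: rainbow_before_def)
next
  case (Suc n)
  then obtain s where
    s: "real (card {l \<in> L. rainbow_before q (\<lambda>t. (X l t + s t) mod q) n})
      \<le> card L * (\<Prod>t<n. 1 - real (t mod 10 - 1) / q)" by blast
  define pos where "pos l = (\<lambda>t. (X l t + s t) mod q)" for l
  define A where "A = {l \<in> L. rainbow_before q (pos l) n}"
  define seen where "seen l = (\<lambda>i. batch_color q i (pos l (10 * (n div 10) + i))) ` {..<n mod 10}" for l
  define B where "B a = {l \<in> A. batch_color q (n mod 10) ((X l n + a) mod q) \<notin> seen l}" for a
  let ?f = "1 - real (n mod 10 - 1) / q"
  have finA: "finite A" using L by (simp add: A_def)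
  \<comment> \<open>For a fixed line the shift runs through all positions once, so the shifts that
    keep it rainbow correspond to positions of unseen color.\<close>
  have good: "card {a \<in> {..<q}. l \<in> B a} \<le> q - (n mod 10 - 1)" if "l \<in> A" for l
  proof -
    let ?good = "{x \<in> {..<q}. batch_color q (n mod 10) x \<notin> seen l}"
    have bij: "bij_betw (\<lambda>a. (X l n + a) mod q) {..<q} {..<q}"
      using q by (intro bij_betw_add_mod) auto
    have "card {a \<in> {..<q}. l \<in> B a} = card ((\<lambda>a. (X l n + a) mod q) ` {a \<in> {..<q}. l \<in> B a})"
      using bij by (intro card_image[symmetric] inj_on_subset[OF bij_betw_imp_inj_on[OF bij]]) auto
    also have "\<dots> \<le> card ?good"
      using q by (intro card_mono) (auto simp: B_def)
    also have "\<dots> \<le> q - (n mod 10 - 1)"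
      unfolding seen_def using that q
      by (intro card_batch_color_avoiding rainbow_before_inj_on) (auto simp: A_def)
    finally show ?thesis .
  qed
  \<comment> \<open>Double counting of the pairs of a shift and a line that it keeps
    rainbow.\<close>
  have "(\<Sum>a<q. card (B a)) = (\<Sum>a<q. \<Sum>l\<in>A. if l \<in> B a then 1 else 0)"
    using finA by (intro sum.cong refl) (auto simp: B_def simp flip: sum.inter_filter)
  also have "\<dots> = (\<Sum>l\<in>A. \<Sum>a<q. if l \<in> B a then 1 else 0)" by (rule sum.swap)
  also have "\<dots> = (\<Sum>l\<in>A. card {a \<in> {..<q}. l \<in> B a})"
    by (simp flip: sum.inter_filter)
  also have "\<dots> \<le> card A * (q - (n mod 10 - 1))"
    using sum_mono[of A _ "\<lambda>_. q - (n mod 10 - 1)"] good by simp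
  finally have total: "(\<Sum>a<q. card (B a)) \<le> card A * (q - (n mod 10 - 1))" .
  \<comment> \<open>Some shift does no worse than the average; multiplying by \<open>q\<close> keeps
    the comparison in the natural numbers.\<close>
  have "\<exists>a<q. card (B a) * q \<le> card A * (q - (n mod 10 - 1))"
  proof (rule ccontr)
    assume "\<not> ?thesis"
    then have "(\<Sum>a<q. card A * (q - (n mod 10 - 1))) < (\<Sum>a<q. card (B a) * q)"
      using q by (intro sum_strict_mono) (auto simp: not_le lessThan_empty_iff)
    then have "q * (card A * (q - (n mod 10 - 1))) < q * (\<Sum>a<q. card (B a))"
      by (simp add: sum_distrib_left mult.commute)
    then show False using mult_le_mono2[OF total, of q] by linarith
  qed
  then obtain a where a: "card (B a) * q \<le> card A * (q - (n mod 10 - 1))" by blast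
  have nq: "n mod 10 - 1 \<le> q" using q by (meson diff_le_self le_trans mod_less_divisor less_imp_le zero_less_numeral)
  have "real (card (B a)) * q \<le> card A * (real q - real (n mod 10 - 1))"
    using a nq by (metis of_nat_diff of_nat_le_iff of_nat_mult)
  then have Ba: "real (card (B a)) \<le> card A * ?f"
    using q by (simp add: field_simps)
  define s' where "s' = s(n := a)"
  have eq: "rainbow_before q (\<lambda>t. (X l t + s' t) mod q) n \<longleftrightarrow> rainbow_before q (pos l) n" for l
    unfolding rainbow_before_def pos_def s'_def by auto
  \<comment> \<open>Altering \<open>s\<close> at \<open>n\<close> leaves the seen colors unchanged,
    because their indices have a remainder below \<open>n mod 10\<close>.\<close>
  have seen': "(\<lambda>i. batch_color q i ((X l (10 * (n div 10) + i) + s' (10 * (n div 10) + i)) mod q)) `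
      {..<n mod 10} = seen l" for l
    unfolding seen_def pos_def s'_def
    by (intro image_cong refl) (auto dest!: arg_cong[of _ n "\<lambda>x. x mod 10"])
  have "{l \<in> L. rainbow_before q (\<lambda>t. (X l t + s' t) mod q) (Suc n)} = B a"
    unfolding rainbow_before_Suc eq seen' B_def A_def by (auto simp: s'_def)
  moreover have "card A * ?f \<le> (card L * (\<Prod>t<n. 1 - real (t mod 10 - 1) / q)) * ?f"
    using s nq q by (intro mult_right_mono) (auto simp: A_def pos_def)
  ultimately show ?case using Ba by (intro exI[of _ s']) (simp add: mult.assoc)
qed

lemma prod_batches_le_exp:
  assumes q: "10 \<le> q"
  shows "(\<Prod>t<10 * j. 1 - real (t mod 10 - 1) / q) \<le> exp (- 36 * real j / q)"
proof (induction j)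
  case (Suc j)
  have "(\<Prod>t<10 * Suc j. 1 - real (t mod 10 - 1) / q) =
    (\<Prod>t<10 * j. 1 - real (t mod 10 - 1) / q) * (\<Prod>i<10. 1 - real (i - 1) / q)"
  proof -
    have "(\<Prod>t<10 * j + 10. 1 - real (t mod 10 - 1) / q) =
      (\<Prod>t<10 * j. 1 - real (t mod 10 - 1) / q) * (\<Prod>t=10*j..<10*j+10. 1 - real (t mod 10 - 1) / q)"
      unfolding lessThan_atLeast0 by (rule prod.atLeastLessThan_concat[symmetric]) auto
    also have "(\<Prod>t=10*j..<10*j+10. 1 - real (t mod 10 - 1) / q) = (\<Prod>i<10. 1 - real (i - 1) / q)"
      using prod.shift_bounds_nat_ivl[of "\<lambda>t. 1 - real (t mod 10 - 1) / q" 0 "10 * j" 10]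
      by (simp add: atLeast0LessThan add.commute)
    finally show ?thesis by (simp add: add.commute)
  qed
  also have "\<dots> \<le> exp (- 36 * real j / q) * exp (- 36 / q)"
  proof (intro mult_mono Suc.IH)
    have "(\<Prod>i<10. 1 - real (i - 1) / q) \<le> (\<Prod>i<10. exp (- (real (i - 1) / q)))"
    proof (intro prod_mono conjI)
      fix i :: nat assume "i \<in> {..<10}"
      then show "0 \<le> 1 - real (i - 1) / q" using q by (auto simp: field_simps)
      show "1 - real (i - 1) / q \<le> exp (- (real (i - 1) / q))"
        using exp_ge_add_one_self[of "- (real (i - 1) / q)"] by simp
    qed
    also have "\<dots> = exp (\<Sum>i<10. - (real (i - 1) / q))" by (simp add: exp_sum)
    \<comment> \<open>With truncated subtraction the numerators are 0, 0, 1, ..., 8, whose sum is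
      36; this is the exponent contributed by one batch.\<close>
    also have "(\<Sum>i<10. - (real (i - 1) / q)) = - 36 / q"
      using q by (simp add: eval_nat_numeral field_simps)
    finally show "(\<Prod>i<10. 1 - real (i - 1) / q) \<le> exp (- 36 / q)" .
    show "0 \<le> (\<Prod>i<10. 1 - real (i - 1) / q)"
      using q by (intro prod_nonneg) (auto simp: field_simps)
  qed auto
  also have "\<dots> = exp (- 36 * real (Suc j) / q)"
    by (simp add: exp_add[symmetric] diff_divide_distrib ring_distribs mult.commute)
  finally show ?case .
qed simp

section \<open>Lines meeting the rays through a point\<close>

text \<open>The arithmetic behind Hall's condition for \<open>n\<close> lines avoiding the centre
  and \<open>c\<close> rays: \<open>N\<close> counts the points they cover on the remaining
  \<open>y + 1\<close> rays. It suffices that \<open>2 * (n + c)\<close> times the second factor is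
  at most the square, which is checked coefficient by coefficient in \<open>n\<^sup>2\<close>,
  \<open>n * c\<close> and \<open>c\<^sup>2\<close>.\<close>

lemma expansion_arith:
  fixes n c y q N :: real
  assumes n0: "0 \<le> n" and c0: "0 \<le> c" and q: "134 \<le> q" and y: "0.3 * q \<le> y" "y \<le> q"
    and nq: "n \<le> q\<^sup>2 / 9"
    and le: "(n * (y + 1) + c * q)\<^sup>2 \<le> N * (n * q + n\<^sup>2 * y / q + 2 * c * n + c * q)"
    and N: "0 \<le> N"
  shows "2 * (n + c) \<le> N"
\<comment> \<open>In this case the factor to be cancelled is zero.\<close>
proof (cases "n = 0 \<and> c = 0")
  case True
  then show ?thesis using N by simp
next
  case False
  define z where "z = n / q"
  have n: "n = z * q" using q by (simp add: z_def)
  have z: "0 \<le> z" using n0 q by (simp add: z_def)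
  have z9: "9 * z \<le> q" using nq q by (simp add: z_def field_simps power2_eq_square)
  let ?Q = "n * q + n\<^sup>2 * y / q + 2 * c * n + c * q"
  have Q: "0 < ?Q"
  proof -
    have "0 \<le> n\<^sup>2 * y / q" "0 \<le> 2 * c * n" "0 \<le> n * q" "0 \<le> c * q" using n0 c0 q y by simp_all
    moreover have "0 < n * q \<or> 0 < c * q" using False n0 c0 q by (simp add: less_le)
    ultimately show ?thesis by linarith
  qed
  have y0: "0 \<le> y" using q y by simp
  have yz: "9 * (y * z) \<le> y * q" using mult_left_mono[OF z9 y0] by simp
  have yy: "0.3 * (y * q) \<le> y * y" using mult_left_mono[OF y(1) y0] by simp
  have qq: "134 * q \<le> q * q" using mult_right_mono[OF q, of q] q by simp
  have qy: "0.3 * (q * q) \<le> y * q" using mult_right_mono[OF y(1), of q] q by simp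
  have zq: "9 * (z * q) \<le> q * q" using mult_right_mono[OF z9, of q] q by simp
  have "(y + 1)\<^sup>2 = y * y + 2 * y + 1" "(y + 1) * q = y * q + q"
    by (simp_all add: power2_eq_square algebra_simps)
  \<comment> \<open>The quadratic terms win by the bounds \<open>9 * z \<le> q\<close> and
    \<open>0.3 * q \<le> y\<close>; for instance 2/9 is below 3/10 in \<open>c1\<close>. The surplus
    absorbs the linear terms because \<open>134 \<le> q\<close>.\<close>
  then have c1: "2 * q + 2 * (y * z) \<le> (y + 1)\<^sup>2"
    and c2: "2 * q + 2 * (z * q) + y * z \<le> (y + 1) * q"
    using yz yy qq qy zq y q by linarith+
  have c3: "4 * (z * q) + 2 * q \<le> q * q" using zq qq q by linarith
  have Qz: "?Q = z * q * q + z * (y * z) * q + 2 * c * z * q + c * q"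
    using q by (simp add: n power2_eq_square)
  have "2 * (n + c) * ?Q = n\<^sup>2 * (2 * q + 2 * (y * z))
      + 2 * n * c * (2 * q + 2 * (z * q) + y * z) + c\<^sup>2 * (4 * (z * q) + 2 * q)"
    unfolding Qz unfolding n by (simp add: power2_eq_square algebra_simps)
  also have "\<dots> \<le> n\<^sup>2 * (y + 1)\<^sup>2 + 2 * n * c * ((y + 1) * q) + c\<^sup>2 * (q * q)"
    using n0 c0 by (intro add_mono mult_left_mono c1 c2 c3) simp_all
  also have "\<dots> = (n * (y + 1) + c * q)\<^sup>2" by (simp add: power2_eq_square algebra_simps)
  also have "\<dots> \<le> N * ?Q" by (rule le)
  finally show ?thesis using Q by (simp add: mult_le_cancel_right)
qed

section \<open>Elementary counting in a projective plane\<close>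

context projective_plane_of_order
begin

lemma finite_line: "l \<in> E \<Longrightarrow> finite l"
  using edge_subset finite_vertices finite_subset by blast

lemma finite_lines: "finite E"
  using edge_subset finite_vertices by (intro finite_subset[of E "Pow V"]) auto

lemma line_eqI:
  assumes "l \<in> E" "m \<in> E" "x \<in> l" "y \<in> l" "x \<in> m" "y \<in> m" "x \<noteq> y"
  shows "l = m"
proof -
  have "x \<in> V" "y \<in> V" using edge_subset[OF assms(1)] assms(3,4) by auto
  then have "\<exists>!l. l \<in> E \<and> x \<in> l \<and> y \<in> l" using assms(7) by (rule unique_line)
  then show ?thesis using assms(1-6) by (auto elim: ex1E)
qed

lemma lines_inter_singleton:
  assumes "l \<in> E" "m \<in> E" "l \<noteq> m"
  shows "\<exists>x. l \<inter> m = {x}"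
proof -
  obtain x where "x \<in> l" "x \<in> m" "\<And>y. y \<in> V \<Longrightarrow> y \<in> l \<Longrightarrow> y \<in> m \<Longrightarrow> y = x"
    using unique_point[OF assms] by (elim ex1E) blast
  then have "l \<inter> m = {x}" using edge_subset[OF assms(1)] by auto
  then show ?thesis ..
qed

text \<open>Take three points of the quadrangle other than \<open>P\<close>. If all lines passed
  through \<open>P\<close>, two lines joining one of them to the others would share that point and
  \<open>P\<close>, hence coincide and carry three points of the quadrangle.\<close>

lemma exists_line_avoiding:
  assumes P: "P \<in> V"
  obtains l where "l \<in> E" "P \<notin> l"
proof (rule ccontr)
  assume "\<not> thesis"
  then have all: "P \<in> l" if "l \<in> E" for l using that \<open>\<And>l. l \<in> E \<Longrightarrow> P \<notin> l \<Longrightarrow> thesis\<close> by blast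
  obtain Q where Q: "Q \<subseteq> V" "card Q = 4" "\<And>l. l \<in> E \<Longrightarrow> card (Q \<inter> l) \<le> 2"
    using quadrangle by blast
  have "finite Q" using Q by (simp add: card_ge_0_finite)
  then have "3 \<le> card (Q - {P})" using Q by (simp add: card_Diff_singleton_if)
  then obtain R where R: "R \<subseteq> Q - {P}" "card R = 3" by (meson obtain_subset_with_card_n)
  then obtain a b c where abc: "R = {a, b, c}" "a \<noteq> b" "b \<noteq> c" "a \<noteq> c"
    by (auto simp: card_3_iff)
  have V: "a \<in> V" "b \<in> V" "c \<in> V" "a \<noteq> P" using R abc Q(1) by auto
  obtain l where l: "l \<in> E" "a \<in> l" "b \<in> l" using unique_line V abc by blast
  obtain m where m: "m \<in> E" "a \<in> m" "c \<in> m" using unique_line V abc by blast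
  have "l = m" using l m all V by (intro line_eqI[of l m a P]) auto
  then have "R \<subseteq> Q \<inter> l" using l m abc R by auto
  then have "3 \<le> card (Q \<inter> l)" using R \<open>finite Q\<close> by (metis card_mono finite_Int)
  then show False using Q(3)[OF l(1)] by simp
qed

text \<open>Projection from \<open>P\<close> matches the lines through \<open>P\<close> with the
  points of a line that avoids \<open>P\<close>.\<close>

lemma card_pencil:
  assumes P: "P \<in> V"
  shows "card {l \<in> E. P \<in> l} = q + 1"
proof -
  obtain m where m: "m \<in> E" "P \<notin> m" by (rule exists_line_avoiding[OF P])
  let ?L = "{l \<in> E. P \<in> l}"
  have one: "card (l \<inter> m) = 1" if "l \<in> ?L" for l
  proof -
    have "\<exists>x. l \<inter> m = {x}" using that m by (intro lines_inter_singleton) auto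
    then show ?thesis by auto
  qed
  have "m = (\<Union>l\<in>?L. l \<inter> m)"
  proof
    show "m \<subseteq> (\<Union>l\<in>?L. l \<inter> m)"
    proof
      fix x assume x: "x \<in> m"
      then have "x \<in> V" "P \<noteq> x" using edge_subset[OF m(1)] m(2) by auto
      then have "\<exists>l. l \<in> E \<and> P \<in> l \<and> x \<in> l" by (intro ex1_implies_ex unique_line[OF P])
      then show "x \<in> (\<Union>l\<in>?L. l \<inter> m)" using x by auto
    qed
  qed auto
  then have "card m = card (\<Union>l\<in>?L. l \<inter> m)" by simp
  also have "\<dots> = (\<Sum>l\<in>?L. card (l \<inter> m))"
    using finite_lines finite_line m line_eqI[of _ _ P]
    by (intro card_UN_disjoint) (simp, simp, blast)
  also have "\<dots> = card ?L" using one by simp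
  finally show ?thesis using line_size[OF m(1)] by simp
qed

text \<open>Two lines through \<open>P\<close> serve as coordinate axes: a line avoiding
  \<open>P\<close> is determined by its points on them, with \<open>q\<close> choices on
  each.\<close>

lemma card_lines_avoiding_le:
  assumes P: "P \<in> V" and q: "1 \<le> q"
  shows "card {l \<in> E. P \<notin> l} \<le> q\<^sup>2"
proof -
  have "2 \<le> card {l \<in> E. P \<in> l}" using card_pencil[OF P] q by simp
  then obtain R where R: "R \<subseteq> {l \<in> E. P \<in> l}" "card R = 2"
    by (meson obtain_subset_with_card_n)
  then obtain g h where gh: "R = {g, h}" "g \<noteq> h" by (auto simp: card_2_iff)
  then have g: "g \<in> E" "P \<in> g" and h: "h \<in> E" "P \<in> h" using R by auto
  obtain z where z: "g \<inter> h = {z}" using lines_inter_singleton[OF g(1) h(1) gh(2)] ..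
  moreover have "P \<in> g \<inter> h" using g h by simp
  ultimately have ghP: "g \<inter> h = {P}" by simp
  let ?L = "{l \<in> E. P \<notin> l}" and ?s = "\<lambda>x :: 'a. {x}"
  let ?f = "\<lambda>l. (l \<inter> g, l \<inter> h)"
  have meets: "\<exists>x. l \<inter> k = {x}" if "l \<in> ?L" "k \<in> E" "P \<in> k" for l k
    using that by (intro lines_inter_singleton) auto
  have "inj_on ?f ?L"
  proof (rule inj_onI)
    fix l m assume l: "l \<in> ?L" and m: "m \<in> ?L" and eq: "?f l = ?f m"
    obtain x where x: "l \<inter> g = {x}" using meets[OF l] g by blast
    obtain y where y: "l \<inter> h = {y}" using meets[OF l] h by blast
    have "x \<noteq> y" using x y ghP l by auto
    then show "l = m" using l m x y eq by (intro line_eqI[of l m x y]) auto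
  qed
  moreover have "?f l \<in> ?s ` (g - {P}) \<times> ?s ` (h - {P})" if l: "l \<in> ?L" for l
  proof -
    obtain x where x: "l \<inter> g = {x}" using meets[OF l] g by blast
    obtain y where y: "l \<inter> h = {y}" using meets[OF l] h by blast
    have "x \<in> g - {P}" "y \<in> h - {P}" using x y l by auto
    then show ?thesis using x y by auto
  qed
  ultimately have "card ?L \<le> card (?s ` (g - {P}) \<times> ?s ` (h - {P}))"
    using g h finite_line by (intro card_inj_on_le[of ?f]) auto
  also have "\<dots> = q * q"
    using g h line_size by (simp add: card_cartesian_product card_image card_Diff_singleton)
  finally show ?thesis by (simp add: power2_eq_square)
qed

end

text \<open>Double counting of incident pairs, weighted at the point. Weight one yields first
  moments of the degrees, and the degree itself as weight yields second moments.\<close>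

lemma sum_card_incidences:
  fixes w :: "'a \<Rightarrow> real"
  assumes "finite A" "finite F"
  shows "(\<Sum>p\<in>A. real (card {l \<in> F. p \<in> l}) * w p) = (\<Sum>l\<in>F. \<Sum>p\<in>A \<inter> l. w p)"
proof -
  have "(\<Sum>p\<in>A. real (card {l \<in> F. p \<in> l}) * w p) = (\<Sum>p\<in>A. \<Sum>l\<in>F. if p \<in> l then w p else 0)"
    using assms(2) by (intro sum.cong refl) (simp flip: sum.inter_filter)
  also have "\<dots> = (\<Sum>l\<in>F. \<Sum>p\<in>A. if p \<in> l then w p else 0)" by (rule sum.swap)
  also have "\<dots> = (\<Sum>l\<in>F. \<Sum>p\<in>A \<inter> l. w p)"
    using assms(1) by (simp add: sum.inter_restrict)
  finally show ?thesis .
qed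

section \<open>The rays through a fixed point\<close>

locale enumerated_pencil = projective_plane_of_order V E q
  for V :: "'a set" and E :: "'a set set" and q :: nat +
  fixes P :: 'a and g :: "nat \<Rightarrow> 'a set"
  assumes centre: "P \<in> V"
    and enumeration: "bij_betw g {..q} {l \<in> E. P \<in> l}"
    and order_pos: "1 \<le> q"
begin

definition ray :: "nat \<Rightarrow> 'a set" where
  "ray t = g t - {P}"

lemma g_line: "t \<le> q \<Longrightarrow> g t \<in> E" "t \<le> q \<Longrightarrow> P \<in> g t"
  using enumeration by (auto simp: bij_betw_def)

lemma ray_subset: "t \<le> q \<Longrightarrow> ray t \<subseteq> V - {P}"
  using edge_subset g_line by (auto simp: ray_def)

lemma finite_ray: "t \<le> q \<Longrightarrow> finite (ray t)"
  using finite_line g_line by (auto simp: ray_def)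

lemma card_ray: "t \<le> q \<Longrightarrow> card (ray t) = q"
  using line_size[OF g_line(1)] g_line(2) finite_line[OF g_line(1)]
  by (simp add: ray_def card_Diff_singleton)

lemma ray_disjoint:
  assumes "t \<le> q" "u \<le> q" "t \<noteq> u"
  shows "ray t \<inter> ray u = {}"
proof -
  have "g t \<noteq> g u" using assms enumeration by (auto simp: bij_betw_def inj_on_def)
  then show ?thesis using line_eqI[of "g t" "g u" _ P] g_line assms by (auto simp: ray_def)
qed

lemma UN_rays: "(\<Union>t\<le>q. ray t) = V - {P}"
proof
  show "(\<Union>t\<le>q. ray t) \<subseteq> V - {P}" using ray_subset by auto
  show "V - {P} \<subseteq> (\<Union>t\<le>q. ray t)"
  proof
    fix x assume x: "x \<in> V - {P}"
    then obtain l where "l \<in> E" "x \<in> l" "P \<in> l" using unique_line centre by blast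
    moreover from this obtain t where "t \<le> q" "l = g t"
      using enumeration by (auto simp: bij_betw_def)
    ultimately show "x \<in> (\<Union>t\<le>q. ray t)" using x by (auto simp: ray_def)
  qed
qed

lemma card_V: "card V = q\<^sup>2 + q + 1"
proof -
  have "card (V - {P}) = (\<Sum>t\<le>q. card (ray t))"
    unfolding UN_rays[symmetric] using finite_ray ray_disjoint
    by (intro card_UN_disjoint) auto
  also have "\<dots> = (q + 1) * q" using card_ray by simp
  finally have "card (V - {P}) = q\<^sup>2 + q" by (simp add: power2_eq_square)
  moreover have "card V = Suc (card (V - {P}))"
    using centre finite_vertices by (intro card.remove) auto
  ultimately show ?thesis by simp
qed

lemma line_inter_ray:
  assumes "l \<in> E" "P \<notin> l" "t \<le> q"
  shows "\<exists>x. l \<inter> ray t = {x}"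
proof -
  have "l \<noteq> g t" using assms g_line by auto
  then obtain x where "l \<inter> g t = {x}"
    using lines_inter_singleton[of l "g t"] assms g_line by blast
  then have "l \<inter> ray t = {x}" using assms by (auto simp: ray_def)
  then show ?thesis ..
qed

lemma sum_rays:
  fixes w :: "'a \<Rightarrow> real"
  assumes "I \<subseteq> {..q}"
  shows "(\<Sum>p\<in>(\<Union>t\<in>I. ray t). w p) = (\<Sum>t\<in>I. \<Sum>p\<in>ray t. w p)"
proof (intro sum.UNION_disjoint ballI impI)
  show "finite I" using assms finite_subset by blast
  show "finite (ray t)" if "t \<in> I" for t using that assms finite_ray by auto
  show "ray t \<inter> ray u = {}" if "t \<in> I" "u \<in> I" "t \<noteq> u" for t u
    using that assms by (intro ray_disjoint) auto
qed

section \<open>Degrees of points with respect to a set of lines avoiding the centre\<close>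

context
  fixes F :: "'a set set"
  assumes F: "F \<subseteq> {l \<in> E. P \<notin> l}"
begin

definition deg :: "'a \<Rightarrow> real" where
  "deg p = real (card {l \<in> F. p \<in> l})"

lemma finite_F: "finite F"
  using finite_lines by (intro finite_subset[OF F]) auto

lemma sum_deg_ray:
  assumes "t \<le> q"
  shows "(\<Sum>p\<in>ray t. deg p) = card F"
proof -
  have "(\<Sum>p\<in>ray t. deg p) = (\<Sum>l\<in>F. real (card (ray t \<inter> l)))"
    using sum_card_incidences[of "ray t" F "\<lambda>_. 1"] finite_ray[OF assms] finite_F
    by (simp add: deg_def)
  also have "\<dots> = (\<Sum>l\<in>F. 1)"
  proof (intro sum.cong refl)
    fix l assume "l \<in> F"
    then have "\<exists>x. l \<inter> ray t = {x}" using F assms by (intro line_inter_ray) auto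
    then show "real (card (ray t \<inter> l)) = 1" by (auto simp: Int_commute)
  qed
  finally show ?thesis by simp
qed

text \<open>The sum counts triples of a point and two lines of \<open>F\<close> through it. Distinct
  lines contribute one point, equal ones \<open>q + 1\<close>.\<close>

lemma sum_deg_square: "(\<Sum>p\<in>V - {P}. (deg p)\<^sup>2) = real (card F) * q + (real (card F))\<^sup>2"
proof -
  have inter: "real (card (l \<inter> m)) = 1 + (if l = m then real q else 0)"
    if lm: "l \<in> F" "m \<in> F" for l m
  proof (cases "l = m")
    case True
    have "card l = q + 1" using lm F by (intro line_size) auto
    then show ?thesis using True by simp
  next
    case False
    then have "\<exists>x. l \<inter> m = {x}" using lm F by (intro lines_inter_singleton) auto
    then obtain x where "l \<inter> m = {x}" ..
    then show ?thesis using False by simp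
  qed
  have "(\<Sum>p\<in>V - {P}. (deg p)\<^sup>2) = (\<Sum>l\<in>F. \<Sum>p\<in>(V - {P}) \<inter> l. deg p)"
    using sum_card_incidences[of "V - {P}" F deg] finite_vertices finite_F
    by (simp add: deg_def power2_eq_square)
  also have "\<dots> = (\<Sum>l\<in>F. \<Sum>p\<in>l. deg p)"
  proof (intro sum.cong refl)
    fix l assume "l \<in> F"
    then show "(V - {P}) \<inter> l = l" using F edge_subset[of l] by auto
  qed
  also have "\<dots> = (\<Sum>l\<in>F. \<Sum>m\<in>F. real (card (l \<inter> m)))"
  proof (intro sum.cong refl)
    fix l assume "l \<in> F"
    then have "finite l" using F finite_line by auto
    then show "(\<Sum>p\<in>l. deg p) = (\<Sum>m\<in>F. real (card (l \<inter> m)))"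
      using sum_card_incidences[of l F "\<lambda>_. 1"] finite_F by (simp add: deg_def)
  qed
  also have "\<dots> = (\<Sum>l\<in>F. \<Sum>m\<in>F. 1 + (if l = m then real q else 0))"
    using inter by simp
  also have "\<dots> = (\<Sum>l\<in>F. real (card F) + q)"
    using finite_F by (simp add: sum.distrib)
  finally show ?thesis by (simp add: power2_eq_square algebra_simps)
qed

text \<open>
  Each of the \<open>m\<close> omitted rays carries at least its average share of the total.
\<close>

lemma sum_deg_square_rays_le:
  assumes "m \<le> q"
  shows "(\<Sum>p\<in>(\<Union>t\<in>{m..q}. ray t). (deg p)\<^sup>2)
    \<le> real (card F) * q + (real (card F))\<^sup>2 * (real q - real m) / q"
proof -
  let ?n = "real (card F)"
  \<comment> \<open>Cauchy-Schwarz on a ray: \<open>q\<close> points whose degrees add up to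
    \<open>card F\<close>.\<close>
  have low: "?n\<^sup>2 / q \<le> (\<Sum>p\<in>ray t. (deg p)\<^sup>2)" if "t \<le> q" for t
    using sum_squared_le_sum_of_squares[of deg "ray t"] sum_deg_ray[OF that] card_ray[OF that]
      order_pos by (simp add: field_simps)
  have "(\<Sum>p\<in>V - {P}. (deg p)\<^sup>2) = (\<Sum>t\<in>{..q}. \<Sum>p\<in>ray t. (deg p)\<^sup>2)"
    unfolding UN_rays[symmetric] by (rule sum_rays) simp
  also have "\<dots> = (\<Sum>t\<in>{..<m}. \<Sum>p\<in>ray t. (deg p)\<^sup>2) + (\<Sum>t\<in>{m..q}. \<Sum>p\<in>ray t. (deg p)\<^sup>2)"
    using assms by (subst sum.union_disjoint[symmetric]) (auto intro!: sum.cong)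
  also have "(\<Sum>t\<in>{m..q}. \<Sum>p\<in>ray t. (deg p)\<^sup>2) = (\<Sum>p\<in>(\<Union>t\<in>{m..q}. ray t). (deg p)\<^sup>2)"
    by (rule sum_rays[symmetric]) auto
  finally have "?n * q + ?n\<^sup>2 = (\<Sum>t\<in>{..<m}. \<Sum>p\<in>ray t. (deg p)\<^sup>2)
      + (\<Sum>p\<in>(\<Union>t\<in>{m..q}. ray t). (deg p)\<^sup>2)" by (simp add: sum_deg_square)
  moreover have "(\<Sum>t\<in>{..<m}. ?n\<^sup>2 / q) \<le> (\<Sum>t\<in>{..<m}. \<Sum>p\<in>ray t. (deg p)\<^sup>2)"
    using assms low by (intro sum_mono) auto
  moreover have "?n * q + ?n\<^sup>2 * (real q - real m) / q = ?n * q + ?n\<^sup>2 - m * (?n\<^sup>2 / q)"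
    using order_pos by (simp add: field_simps)
  ultimately show ?thesis by simp
qed

text \<open>
  Cauchy-Schwarz for the number of lines of \<open>F\<close> and of selected rays through a point of \<open>Y\<close>.
\<close>

lemma square_incidences_le:
  assumes m: "m \<le> q" and \<Gamma>: "\<Gamma> \<subseteq> {m..q}"
  defines "Y \<equiv> (\<Union>t\<in>{m..q}. ray t) \<inter> (\<Union>F \<union> (\<Union>t\<in>\<Gamma>. ray t))"
  shows "(real (card F) * (real q - m + 1) + real (card \<Gamma>) * q)\<^sup>2 \<le> real (card Y) *
    (real (card F) * q + (real (card F))\<^sup>2 * (real q - m) / q
      + 2 * real (card \<Gamma>) * card F + real (card \<Gamma>) * q)"
proof -
  let ?T = "\<Union>t\<in>{m..q}. ray t" and ?R = "\<Union>t\<in>\<Gamma>. ray t"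
  let ?n = "real (card F)" and ?c = "real (card \<Gamma>)"
  \<comment> \<open>Rays are disjoint, so this indicator is also the number of selected rays through
    \<open>p\<close>, and it equals its own square.\<close>
  define ch :: "'a \<Rightarrow> real" where "ch p = (if p \<in> ?R then 1 else 0)" for p
  have finT: "finite ?T" using finite_ray by auto
  have RT: "?R \<subseteq> ?T" using \<Gamma> by auto
  have sum_ch: "(\<Sum>p\<in>?T. w p * ch p) = (\<Sum>t\<in>\<Gamma>. \<Sum>p\<in>ray t. w p)" for w
  proof -
    have "(\<Sum>p\<in>?T. w p * ch p) = (\<Sum>p\<in>?R. w p)"
      using finT RT by (intro sum.mono_neutral_cong_right) (auto simp: ch_def)
    also have "\<dots> = (\<Sum>t\<in>\<Gamma>. \<Sum>p\<in>ray t. w p)" using \<Gamma> by (intro sum_rays) auto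
    finally show ?thesis .
  qed
  have ch1: "(\<Sum>p\<in>?T. ch p) = ?c * q"
    using sum_ch[of "\<lambda>_. 1"] \<Gamma> card_ray by (simp add: subset_iff)
  \<comment> \<open>Each line of \<open>F\<close> meets each selected ray exactly once.\<close>
  have degch: "(\<Sum>p\<in>?T. deg p * ch p) = ?c * ?n"
    using sum_ch[of deg] \<Gamma> sum_deg_ray by (simp add: subset_iff)
  have "(\<Sum>p\<in>?T. deg p) = (\<Sum>t\<in>{m..q}. \<Sum>p\<in>ray t. deg p)" by (rule sum_rays) auto
  also have "\<dots> = (real q - m + 1) * ?n" using sum_deg_ray m by (simp add: of_nat_diff)
  finally have deg1: "(\<Sum>p\<in>?T. deg p) = (real q - m + 1) * ?n" .
  have zero: "deg p + ch p = 0" if "p \<in> ?T - Y" for p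
    using that finite_F by (auto simp: Y_def deg_def ch_def card_eq_0_iff)
  \<comment> \<open>The summand vanishes off \<open>Y\<close>, so the total over the remaining rays
    is carried by \<open>Y\<close> alone and \<open>card Y\<close> enters the Cauchy-Schwarz
    bound.\<close>
  have "(\<Sum>p\<in>Y. deg p + ch p) = (\<Sum>p\<in>?T. deg p + ch p)"
    using finT zero by (intro sum.mono_neutral_left) (auto simp: Y_def)
  also have "\<dots> = ?n * (real q - m + 1) + ?c * q"
    using deg1 ch1 by (simp add: sum.distrib mult.commute)
  finally have lin: "(\<Sum>p\<in>Y. deg p + ch p) = ?n * (real q - m + 1) + ?c * q" .
  have "(\<Sum>p\<in>Y. (deg p + ch p)\<^sup>2) \<le> (\<Sum>p\<in>?T. (deg p + ch p)\<^sup>2)"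
    using finT by (intro sum_mono2) (auto simp: Y_def)
  also have "\<dots> = (\<Sum>p\<in>?T. (deg p)\<^sup>2 + 2 * (deg p * ch p) + ch p)"
    by (intro sum.cong refl) (simp add: power2_eq_square ch_def algebra_simps)
  also have "\<dots> = (\<Sum>p\<in>?T. (deg p)\<^sup>2) + 2 * (?c * ?n) + ?c * q"
    using degch ch1 by (simp add: sum.distrib flip: sum_distrib_left)
  also have "\<dots> \<le> ?n * q + ?n\<^sup>2 * (real q - m) / q + 2 * ?c * ?n + ?c * q"
    using sum_deg_square_rays_le[OF m] by simp
  finally have "(\<Sum>p\<in>Y. (deg p + ch p)\<^sup>2) \<le> \<dots>" .
  then have "(\<Sum>p\<in>Y. (deg p + ch p)\<^sup>2) * real (card Y) \<le>
     (?n * q + ?n\<^sup>2 * (real q - m) / q + 2 * ?c * ?n + ?c * q) * real (card Y)"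
    by (intro mult_right_mono) auto
  then show ?thesis
    using sum_squared_le_sum_of_squares[of "\<lambda>p. deg p + ch p" Y] lin by (simp add: mult.commute)
qed

end

end

section \<open>Splitting a set into classes of size ten\<close>

text \<open>The two points of each pair receive consecutive numbers \<open>2 * k\<close> and
  \<open>2 * k + 1\<close>, and all pairs precede the other points. Blocks of even length counted
  from zero then never separate a pair.\<close>

lemma exists_pair_enumeration:
  fixes r :: "'l \<times> bool \<Rightarrow> 'a"
  assumes A: "finite A" and D: "finite D"
    and inj: "inj_on r (D \<times> UNIV)" and sub: "r ` (D \<times> UNIV) \<subseteq> A"
  shows "\<exists>\<sigma>. bij_betw \<sigma> A {..<card A} \<and>
    (\<forall>l\<in>D. \<sigma> (r (l, False)) div 2 = \<sigma> (r (l, True)) div 2 \<and> (\<forall>b. \<sigma> (r (l, b)) < 2 * card D))"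
proof -
  define R where "R = r ` (D \<times> UNIV)"
  obtain \<iota> where "bij_betw \<iota> D {0..<card D}" using ex_bij_betw_finite_nat[OF D] by blast
  then have \<iota>: "inj_on \<iota> D" "\<And>l. l \<in> D \<Longrightarrow> \<iota> l < card D"
    by (auto simp: bij_betw_def)
  define \<rho> :: "'l \<times> bool \<Rightarrow> nat" where "\<rho> x = 2 * \<iota> (fst x) + of_bool (snd x)" for x
  define \<sigma>1 where "\<sigma>1 = \<rho> \<circ> inv_into (D \<times> UNIV) r"
  have \<sigma>1: "\<sigma>1 (r (l, b)) = 2 * \<iota> l + of_bool b" if "l \<in> D" for l b
    using that inv_into_f_f[OF inj, of "(l, b)"] by (simp add: \<sigma>1_def \<rho>_def)
  have cardR: "card R = 2 * card D"
    unfolding R_def using card_image[OF inj] by (simp add: card_cartesian_product mult.commute)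
  have finR: "finite R" using D by (simp add: R_def)
  have "inj_on \<sigma>1 R"
  proof (rule inj_onI)
    fix x y assume x: "x \<in> R" and y: "y \<in> R" and eq: "\<sigma>1 x = \<sigma>1 y"
    obtain l b where lb: "x = r (l, b)" "l \<in> D" using x by (auto simp: R_def)
    obtain l' b' where lb': "y = r (l', b')" "l' \<in> D" using y by (auto simp: R_def)
    have e: "2 * \<iota> l + of_bool b = 2 * \<iota> l' + of_bool b'" using eq lb lb' \<sigma>1 by simp
    then have "\<iota> l = \<iota> l'" "b = b'" by (cases b; cases b'; simp; presburger)+
    then show "x = y" using lb lb' \<iota>(1) by (simp add: inj_on_eq_iff)
  qed
  moreover have sub1: "\<sigma>1 ` R \<subseteq> {..<2 * card D}"
  proof
    fix i assume "i \<in> \<sigma>1 ` R"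
    then obtain l b where "l \<in> D" "i = \<sigma>1 (r (l, b))" by (auto simp: R_def)
    then show "i \<in> {..<2 * card D}" using \<sigma>1[of l b] \<iota>(2)[of l] by (cases b) auto
  qed
  ultimately have bij1: "bij_betw \<sigma>1 R {..<2 * card D}"
    using cardR by (simp add: bij_betw_def card_image card_subset_eq)
  have RA: "R \<subseteq> A" using sub by (simp add: R_def)
  then have le: "2 * card D \<le> card A" using card_mono[OF A RA] cardR by simp
  have "card (A - R) = card {2 * card D..<card A}"
    using RA finR cardR by (simp add: card_Diff_subset)
  then obtain \<sigma>2 where bij2: "bij_betw \<sigma>2 (A - R) {2 * card D..<card A}"
    using A finite_same_card_bij[of "A - R" "{2 * card D..<card A}"] by auto
  define \<sigma> where "\<sigma> x = (if x \<in> R then \<sigma>1 x else \<sigma>2 x)" for x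
  have "bij_betw \<sigma> R {..<2 * card D}"
    using bij1 by (rule bij_betw_cong[THEN iffD1, rotated]) (simp add: \<sigma>_def)
  moreover have "bij_betw \<sigma> (A - R) {2 * card D..<card A}"
    using bij2 by (rule bij_betw_cong[THEN iffD1, rotated]) (simp add: \<sigma>_def)
  ultimately have "bij_betw \<sigma> (R \<union> (A - R)) ({..<2 * card D} \<union> {2 * card D..<card A})"
    by (rule bij_betw_combine) auto
  moreover have "R \<union> (A - R) = A" using RA by blast
  moreover have "{..<2 * card D} \<union> {2 * card D..<card A} = {..<card A}" using le by auto
  ultimately have "bij_betw \<sigma> A {..<card A}" by simp
  moreover have "\<sigma> (r (l, b)) = 2 * \<iota> l + of_bool b" if "l \<in> D" for l b
    using that \<sigma>1 by (simp add: \<sigma>_def R_def)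
  then have "\<sigma> (r (l, False)) div 2 = \<sigma> (r (l, True)) div 2 \<and> (\<forall>b. \<sigma> (r (l, b)) < 2 * card D)"
    if "l \<in> D" for l
    using that \<iota>(2)[OF that] by (auto simp: of_bool_def)
  ultimately show ?thesis by blast
qed

text \<open>Consecutive blocks of ten; leftover numbers from \<open>10 * N\<close> on go one each to
  the classes 0, 1, and so on.\<close>

definition chunk :: "nat \<Rightarrow> nat \<Rightarrow> nat" where
  "chunk N i = (if i < 10 * N then i div 10 else i - 10 * N)"

lemma card_chunk_fibre:
  assumes "M = 10 * N + r" "r \<le> N" "c < N"
  shows "card {i \<in> {..<M}. chunk N i = c} \<in> {10, 11}"
proof -
  have "{i \<in> {..<M}. chunk N i = c} = {10 * c..<10 * c + 10} \<union> (if c < r then {10 * N + c} else {})"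
    using assms by (auto simp: chunk_def split: if_splits)
  moreover have "10 * N + c \<notin> {10 * c..<10 * c + 10}" using assms by auto
  ultimately show ?thesis by auto
qed

lemma chunk_less: "i < 10 * N + r \<Longrightarrow> r \<le> N \<Longrightarrow> chunk N i < N"
  by (cases "i < 10 * N") (auto simp: chunk_def less_mult_imp_div_less mult.commute)

text \<open>Ten is even: dividing by two and then by five is dividing by ten.\<close>

lemma chunk_eqI: "i div 2 = k div 2 \<Longrightarrow> i < 10 * N \<Longrightarrow> k < 10 * N \<Longrightarrow> chunk N i = chunk N k"
  using div_mult2_eq[of i 2 5] div_mult2_eq[of k 2 5] by (simp add: chunk_def)

section \<open>The coloring\<close>

context enumerated_pencil
begin

text \<open>Hall's theorem with every line taken twice, the copies labelled by a boolean. A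
  subfamily splits into lines \<open>F\<close> avoiding \<open>P\<close> and rays
  \<open>\<Gamma>\<close>; forgetting the labels costs the factor two that the expansion estimate
  provides.\<close>

lemma exists_disjoint_pairs:
  assumes U: "U \<subseteq> {l \<in> E. P \<notin> l}" and small: "real (card U) \<le> (real q)\<^sup>2 / 9"
    and m: "m \<le> q" "3 / 10 * real q \<le> real q - real m" and q: "134 \<le> q"
  defines "D \<equiv> U \<union> g ` {m..q}"
  shows "\<exists>r :: 'a set \<times> bool \<Rightarrow> 'a. inj_on r (D \<times> UNIV) \<and>
    (\<forall>l\<in>D. \<forall>b. r (l, b) \<in> l \<inter> (\<Union>t\<in>{m..q}. ray t))"
proof -
  let ?T = "\<Union>t\<in>{m..q}. ray t"
  have finU: "finite U" using finite_lines by (intro finite_subset[OF U]) auto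
  have finD: "finite D" using finU by (simp add: D_def)
  have DE: "l \<in> E" if "l \<in> D" for l using that U g_line by (auto simp: D_def)
  have "\<exists>r. (\<forall>x\<in>D \<times> UNIV. r x \<in> fst x \<inter> ?T) \<and> inj_on r (D \<times> (UNIV :: bool set))"
  proof (rule hall_marriage)
    show "finite (D \<times> (UNIV :: bool set))" using finD by simp
    show "finite (fst x \<inter> ?T)" if "x \<in> D \<times> (UNIV :: bool set)" for x
      using that DE finite_line by auto
    fix J assume J: "J \<subseteq> D \<times> (UNIV :: bool set)"
    define F where "F = fst ` J \<inter> U"
    define \<Gamma> where "\<Gamma> = {t \<in> {m..q}. g t \<in> fst ` J}"
    define Y where "Y = ?T \<inter> (\<Union>F \<union> (\<Union>t\<in>\<Gamma>. ray t))"
    have finF: "finite F" using finU by (simp add: F_def)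
    have "J \<subseteq> (F \<union> g ` \<Gamma>) \<times> UNIV"
    proof
      fix x assume x: "x \<in> J"
      then have "fst x \<in> D" "fst x \<in> fst ` J" using J by auto
      then have "fst x \<in> F \<union> g ` \<Gamma>" unfolding D_def F_def \<Gamma>_def by blast
      then show "x \<in> (F \<union> g ` \<Gamma>) \<times> UNIV" by (simp add: mem_Times_iff)
    qed
    then have "card J \<le> card ((F \<union> g ` \<Gamma>) \<times> (UNIV :: bool set))"
      using finF by (intro card_mono) (auto simp: \<Gamma>_def)
    also have "\<dots> = 2 * card (F \<union> g ` \<Gamma>)" by (simp add: card_cartesian_product)
    also have "\<dots> \<le> 2 * (card F + card \<Gamma>)"
      using card_Un_le[of F "g ` \<Gamma>"] card_image_le[of \<Gamma> g] by (simp add: \<Gamma>_def)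
    finally have cardJ: "card J \<le> 2 * (card F + card \<Gamma>)" .
    have "card F \<le> card U" using finU by (intro card_mono) (auto simp: F_def)
    then have Fle: "real (card F) \<le> (real q)\<^sup>2 / 9" using small by linarith
    have FE: "F \<subseteq> {l \<in> E. P \<notin> l}" using U by (auto simp: F_def)
    have "\<Gamma> \<subseteq> {m..q}" by (auto simp: \<Gamma>_def)
    note square_incidences_le[OF FE m(1) this]
    then have "2 * (real (card F) + real (card \<Gamma>)) \<le> real (card Y)"
      using m q Fle unfolding Y_def
      by (intro expansion_arith[where q = "real q" and y = "real q - real m"]) auto
    then have "real (2 * (card F + card \<Gamma>)) \<le> real (card Y)" by simp
    then have "2 * (card F + card \<Gamma>) \<le> card Y" by (simp only: of_nat_le_iff)
    also have "Y \<subseteq> (\<Union>x\<in>J. fst x \<inter> ?T)"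
      unfolding Y_def F_def \<Gamma>_def by (fastforce simp: ray_def)
    then have "card Y \<le> card (\<Union>x\<in>J. fst x \<inter> ?T)"
      using finite_ray by (intro card_mono) (auto intro: finite_subset[of _ ?T])
    finally show "card J \<le> card (\<Union>x\<in>J. fst x \<inter> ?T)" using cardJ by linarith
  qed
  then show ?thesis by fastforce
qed

lemma exists_tail_coloring:
  assumes U: "U \<subseteq> {l \<in> E. P \<notin> l}" and small: "real (card U) \<le> (real q)\<^sup>2 / 9"
    and m: "m \<le> q" "3 / 10 * real q \<le> real q - real m" and q: "134 \<le> q"
  defines "A \<equiv> insert P (\<Union>t\<in>{m..q}. ray t)"
    and "N \<equiv> ((q + 1 - m) * q + 1) div 10"
  shows "\<exists>h. h ` A \<subseteq> {..<N} \<and> (\<forall>c<N. card {x \<in> A. h x = c} \<in> {10, 11 :: nat}) \<and>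
    (\<forall>l\<in>U \<union> g ` {m..q}. \<exists>x\<in>l \<inter> A. \<exists>y\<in>l \<inter> A. x \<noteq> y \<and> h x = h y)"
proof -
  let ?T = "\<Union>t\<in>{m..q}. ray t" and ?D = "U \<union> g ` {m..q}"
  define M where "M = (q + 1 - m) * q + 1"
  have finU: "finite U" using finite_lines by (intro finite_subset[OF U]) auto
  have finA: "finite A" using finite_ray by (auto simp: A_def)
  have "P \<notin> ?T" by (auto simp: ray_def)
  moreover have "card ?T = (\<Sum>t\<in>{m..q}. card (ray t))"
    using finite_ray ray_disjoint by (intro card_UN_disjoint) auto
  then have "card ?T = (q + 1 - m) * q" using card_ray by simp
  moreover have "finite ?T" using finite_ray by auto
  ultimately have cardA: "card A = M" by (simp add: A_def M_def)
  obtain r :: "'a set \<times> bool \<Rightarrow> 'a" where r: "inj_on r (?D \<times> UNIV)"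
      "\<And>l b. l \<in> ?D \<Longrightarrow> r (l, b) \<in> l \<inter> ?T"
    using exists_disjoint_pairs[OF U small m q] by blast
  have "r ` (?D \<times> UNIV) \<subseteq> A" using r(2) by (auto simp: A_def)
  then obtain \<sigma> where \<sigma>: "bij_betw \<sigma> A {..<M}"
    and pairs: "\<And>l. l \<in> ?D \<Longrightarrow> \<sigma> (r (l, False)) div 2 = \<sigma> (r (l, True)) div 2"
      "\<And>l b. l \<in> ?D \<Longrightarrow> \<sigma> (r (l, b)) < 2 * card ?D"
    using exists_pair_enumeration[OF finA, of ?D r] finU r(1) cardA by blast
  have MN: "M = 10 * N + M mod 10" unfolding N_def M_def[symmetric] by simp
  have kq: "real M = (real q - m + 1) * q + 1" using m by (simp add: M_def of_nat_diff)
  have lowM: "(3 / 10 * real q + 1) * q \<le> (real q - m + 1) * q"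
    using m by (intro mult_right_mono) auto
  have q2: "134 * real q \<le> real q * q" using q by (intro mult_right_mono) auto
  have "M mod 10 \<le> 9" using mod_less_divisor[of 10 M] by linarith
  then have N10: "M \<le> 10 * N + 9" using MN by linarith
  have "(3 / 10 * real q + 1) * q = 3 / 10 * (real q * q) + q" by (simp add: algebra_simps)
  \<comment> \<open>At most nine points are left over, so this forces \<open>10 \<le> N\<close>; the
    leftovers therefore fit into distinct classes.\<close>
  then have "real M \<ge> 109" using kq lowM q2 q by linarith
  then have "10 \<le> N" using N10 by linarith
  then have rN: "M mod 10 \<le> N" using \<open>M mod 10 \<le> 9\<close> by linarith
  \<comment> \<open>All pairs must lie within the full blocks, before the leftovers. The pairs take
    about \<open>2 * q\<^sup>2 / 9\<close> points, while at least \<open>3 * q\<^sup>2 / 10\<close>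
    are available.\<close>
  have DN: "2 * card ?D \<le> 10 * N"
  proof -
    have "card ?D \<le> card U + (q + 1 - m)"
      using card_Un_le[of U "g ` {m..q}"] card_image_le[of "{m..q}" g] by simp
    then have "real (card ?D) \<le> real (card U) + (real q - m + 1)" using m by linarith
    then have d: "2 * real (card ?D) \<le> 2 * (real q * q / 9) + 2 * (real q - m + 1)"
      using small by (simp add: power2_eq_square)
    have "(3 / 10 * real q) * (real q - 2) \<le> (real q - m + 1) * (real q - 2)"
      using m q by (intro mult_right_mono) auto
    moreover have "3 / 10 * real q * (real q - 2) = 3 / 10 * (real q * q) - 6 / 10 * q"
      "(real q - m + 1) * (real q - 2) = (real q - m + 1) * q - 2 * (real q - m + 1)"
      by (simp_all add: algebra_simps diff_divide_distrib)
    ultimately have "2 * (real q * q / 9) + 2 * (real q - m + 1) + 8 \<le> (real q - m + 1) * q"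
      using q2 q by linarith
    then have "2 * real (card ?D) + 9 \<le> real M" using d kq by linarith
    then show ?thesis using N10 by linarith
  qed
  define h where "h = chunk N \<circ> \<sigma>"
  have "h ` A \<subseteq> {..<N}"
  proof
    fix c assume "c \<in> h ` A"
    then obtain x where "x \<in> A" "c = chunk N (\<sigma> x)" by (auto simp: h_def)
    moreover then have "\<sigma> x < M" using \<sigma> by (auto simp: bij_betw_def)
    ultimately show "c \<in> {..<N}" using chunk_less[OF _ rN] MN by simp
  qed
  moreover have "card {x \<in> A. h x = c} \<in> {10, 11}" if "c < N" for c
  proof -
    have "bij_betw \<sigma> {x \<in> A. h x = c} {i \<in> {..<M}. chunk N i = c}"
      using \<sigma> by (auto simp: bij_betw_def inj_on_def h_def image_iff) 
    then have "card {x \<in> A. h x = c} = card {i \<in> {..<M}. chunk N i = c}"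
      by (rule bij_betw_same_card)
    then show ?thesis using card_chunk_fibre[OF MN rN that] by simp
  qed
  moreover have "\<exists>x\<in>l \<inter> A. \<exists>y\<in>l \<inter> A. x \<noteq> y \<and> h x = h y" if l: "l \<in> ?D" for l
  proof -
    have mem: "r (l, b) \<in> l \<inter> A" for b using r(2)[OF l, of b] by (simp add: A_def)
    have "r (l, False) \<noteq> r (l, True)" using r(1) l by (auto dest: inj_onD)
    moreover have "h (r (l, False)) = h (r (l, True))"
      unfolding h_def comp_def
      by (intro chunk_eqI pairs(1)[OF l] less_le_trans[OF pairs(2)[OF l] DN])
    ultimately show ?thesis using mem[of False] mem[of True] by blast
  qed
  ultimately show ?thesis by blast
qed

text \<open>A color is a batch number together with a color inside the batch. \<open>U\<close>
  collects the lines avoiding \<open>P\<close> that stay rainbow after the shifts chosen by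
  averaging.\<close>

lemma exists_head_coloring:
  assumes j: "10 * j \<le> q" and q: "10 \<le> q"
  defines "A \<equiv> \<Union>t\<in>{..<10 * j}. ray t"
  shows "\<exists>(h :: 'a \<Rightarrow> nat \<times> nat) U. h ` A \<subseteq> {..<j} \<times> {..<q} \<and>
    (\<forall>c\<in>{..<j} \<times> {..<q}. card {x \<in> A. h x = c} = 10) \<and>
    U \<subseteq> {l \<in> E. P \<notin> l} \<and> real (card U) \<le> (real q)\<^sup>2 * exp (- 36 * real j / q) \<and>
    (\<forall>l\<in>({l \<in> E. P \<notin> l} - U) \<union> g ` {..<10 * j}. \<exists>x\<in>l \<inter> A. \<exists>y\<in>l \<inter> A. x \<noteq> y \<and> h x = h y)"
proof -
  let ?L = "{l \<in> E. P \<notin> l}"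
  have "\<exists>e. bij_betw e (ray t) {..<q}" if "t \<le> q" for t
    using ex_bij_betw_finite_nat[OF finite_ray[OF that]] card_ray[OF that]
    by (simp add: atLeast0LessThan)
  then obtain e where e: "\<And>t. t \<le> q \<Longrightarrow> bij_betw (e t) (ray t) {..<q}" by metis
  define pt where "pt l t = the_elem (l \<inter> ray t)" for l t
  have pt: "l \<inter> ray t = {pt l t}" if "l \<in> ?L" "t \<le> q" for l t
  proof -
    have "\<exists>x. l \<inter> ray t = {x}" using that by (intro line_inter_ray) auto
    then obtain x where "l \<inter> ray t = {x}" ..
    then show ?thesis by (simp add: pt_def)
  qed
  have finL: "finite ?L" using finite_lines by simp
  obtain s where s: "real (card {l \<in> ?L. rainbow_before q (\<lambda>t. (e t (pt l t) + s t) mod q) (10 * j)})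
      \<le> card ?L * (\<Prod>t<10 * j. 1 - real (t mod 10 - 1) / q)"
    using exists_shifts_few_rainbow[OF finL q, of "\<lambda>l t. e t (pt l t)" "10 * j"]
    by (elim exE) (rule that)
  define pos where "pos t x = (e t x + s t) mod q" for t x
  define U where "U = {l \<in> ?L. rainbow_before q (\<lambda>t. pos t (pt l t)) (10 * j)}"
  have pos: "bij_betw (pos t) (ray t) {..<q}" if "t \<le> q" for t
  proof -
    have "bij_betw ((\<lambda>i. (s t + i) mod q) \<circ> e t) (ray t) {..<q}"
      using e[OF that] bij_betw_add_mod[of q "s t"] q by (intro bij_betw_trans[of "e t"]) auto
    moreover have "(\<lambda>i. (s t + i) mod q) \<circ> e t = pos t"
      by (auto simp: pos_def add.commute)
    ultimately show ?thesis by simp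
  qed
  define idx where "idx x = (THE t. t \<le> q \<and> x \<in> ray t)" for x
  have idx: "idx x = t" if "t \<le> q" "x \<in> ray t" for x t
    unfolding idx_def using that ray_disjoint by (intro the_equality) auto
  define h where "h x = (idx x div 10, batch_color q (idx x mod 10) (pos (idx x) x))" for x
  have h: "h x = (t div 10, batch_color q (t mod 10) (pos t x))" if "t \<le> q" "x \<in> ray t" for x t
    using idx[OF that] by (simp add: h_def)
  have "h ` A \<subseteq> {..<j} \<times> {..<q}"
  proof
    fix c assume "c \<in> h ` A"
    then obtain t x where "t < 10 * j" "x \<in> ray t" "c = h x" by (auto simp: A_def)
    then show "c \<in> {..<j} \<times> {..<q}" using h[of t x] j q batch_color_less[of q]
      by (simp add: less_mult_imp_div_less mult.commute)
  qed
  moreover have "card {x \<in> A. h x = (b, c)} = 10" if b: "b < j" and c: "c < q" for b c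
  proof -
    let ?S = "{(i, p) \<in> {..<10} \<times> {..<q}. batch_color q i p = c}"
    \<comment> \<open>Within one batch a point is encoded by its ray index and its shifted position,
      which turns the color class into a fibre of \<open>batch_color\<close>.\<close>
    let ?\<phi> = "\<lambda>x. (idx x mod 10, pos (idx x) x)"
    have "bij_betw ?\<phi> {x \<in> A. h x = (b, c)} ?S"
    proof (rule bij_betwI')
      fix x y assume x: "x \<in> {x \<in> A. h x = (b, c)}" and y: "y \<in> {x \<in> A. h x = (b, c)}"
      obtain t where t: "t < 10 * j" "x \<in> ray t" using x by (auto simp: A_def)
      obtain u where u: "u < 10 * j" "y \<in> ray u" using y by (auto simp: A_def)
      have it: "idx x = t" "idx y = u" using t u j by (auto intro: idx)
      have div: "t div 10 = b" "u div 10 = b" using x y it by (auto simp: h_def)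
      show "(?\<phi> x = ?\<phi> y) = (x = y)"
      proof
        assume eq: "?\<phi> x = ?\<phi> y"
        then have "t mod 10 = u mod 10" by (simp add: it)
        then have "t = u" using div by (metis div_mult_mod_eq)
        then show "x = y" using eq t u j it bij_betw_imp_inj_on[OF pos[of t]]
          by (auto dest: inj_onD)
      qed simp
    next
      fix x assume x: "x \<in> {x \<in> A. h x = (b, c)}"
      obtain t where t: "t < 10 * j" "x \<in> ray t" using x by (auto simp: A_def)
      have "idx x = t" using t j by (auto intro: idx)
      moreover have "pos t x < q" using q by (simp add: pos_def)
      ultimately show "?\<phi> x \<in> ?S" using x by (auto simp: h_def)
    next
      fix z assume "z \<in> ?S"
      then obtain i p where z: "z = (i, p)" "i < 10" "p < q" "batch_color q i p = c" by auto
      define t where "t = 10 * b + i"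
      have t: "t < 10 * j" "t div 10 = b" "t mod 10 = i" using b z by (auto simp: t_def)
      then obtain x where x: "x \<in> ray t" "pos t x = p"
        using pos[of t] j z by (auto simp: bij_betw_def image_iff) (metis image_iff lessThan_iff)
      have "idx x = t" using x t j by (auto intro: idx)
      then show "\<exists>x\<in>{x \<in> A. h x = (b, c)}. z = ?\<phi> x"
        using x t z by (intro bexI[of _ x]) (auto simp: h_def A_def)
    qed
    then have "card {x \<in> A. h x = (b, c)} = card ?S" by (rule bij_betw_same_card)
    then show ?thesis using card_batch_color_fibre[of q c] c q by simp
  qed
  then have "\<forall>c\<in>{..<j} \<times> {..<q}. card {x \<in> A. h x = c} = 10" by auto
  moreover have "U \<subseteq> ?L" by (auto simp: U_def)
  moreover have "real (card U) \<le> (real q)\<^sup>2 * exp (- 36 * real j / q)"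
  proof -
    have "real (card U) \<le> real (card ?L) * (\<Prod>t<10 * j. 1 - real (t mod 10 - 1) / q)"
      using s by (simp add: U_def pos_def)
    also have "\<dots> \<le> real (card ?L) * exp (- 36 * real j / q)"
      using prod_batches_le_exp[of q j] q by (intro mult_left_mono) auto
    also have "\<dots> \<le> (real q)\<^sup>2 * exp (- 36 * real j / q)"
      using card_lines_avoiding_le[OF centre order_pos]
      by (intro mult_right_mono) (auto simp flip: of_nat_power)
    finally show ?thesis .
  qed
  moreover have "\<exists>x\<in>l \<inter> A. \<exists>y\<in>l \<inter> A. x \<noteq> y \<and> h x = h y"
    if "l \<in> (?L - U) \<union> g ` {..<10 * j}" for l
    using that
  proof
    assume l: "l \<in> ?L - U"
    then obtain t u where tu: "t < 10 * j" "u < t" "t div 10 = u div 10"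
      "batch_color q (t mod 10) (pos t (pt l t)) = batch_color q (u mod 10) (pos u (pt l u))"
      by (auto simp: U_def rainbow_before_def)
    have le: "t \<le> q" "u \<le> q" "u < 10 * j" using tu j by auto
    have t: "pt l t \<in> l" "pt l t \<in> ray t" using pt[of l t] l le by blast+
    have u: "pt l u \<in> l" "pt l u \<in> ray u" using pt[of l u] l le by blast+
    have "pt l t \<noteq> pt l u" using t u ray_disjoint[of t u] le tu by auto
    moreover have "h (pt l t) = h (pt l u)"
      using h[OF le(1) t(2)] h[OF le(2) u(2)] tu by simp
    moreover have "pt l t \<in> l \<inter> A" "pt l u \<in> l \<inter> A" using t u tu le by (auto simp: A_def)
    ultimately show ?thesis by blast
  next
    assume "l \<in> g ` {..<10 * j}"
    then obtain t where t: "t < 10 * j" "l = g t" by auto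
    \<comment> \<open>A ray contains all positions, in particular \<open>q - 2\<close> and
      \<open>q - 1\<close>, which share a color.\<close>
    have surj: "\<exists>x\<in>ray t. pos t x = p" if "p < q" for p
      using pos[of t] t j that by (auto simp: bij_betw_def) (metis image_iff lessThan_iff)
    obtain x where x: "x \<in> ray t" "pos t x = q - 2" using surj[of "q - 2"] q by auto
    obtain y where y: "y \<in> ray t" "pos t y = q - 1" using surj[of "q - 1"] q by auto
    have "x \<noteq> y" using x y q by auto
    moreover have "h x = h y" using x y h[of t] t j q by (simp add: batch_color_def)
    moreover have "x \<in> l \<inter> A" "y \<in> l \<inter> A" using x y t by (auto simp: A_def ray_def)
    ultimately show ?thesis by blast
  qed
  then have "\<forall>l\<in>(?L - U) \<union> g ` {..<10 * j}. \<exists>x\<in>l \<inter> A. \<exists>y\<in>l \<inter> A. x \<noteq> y \<and> h x = h y"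
    by (rule ballI)
  ultimately show ?thesis by (intro exI[of _ h] exI[of _ U] conjI)
qed

text \<open>The two partial colorings are glued. The first \<open>10 * j\<close> rays use exactly
  ten points per color, so the only loss is the remainder of at most nine points on the other
  side.\<close>

lemma card_V_le_balanced_upper_chromatic_number:
  assumes j: "10 * j \<le> q" "3 / 10 * real q \<le> real q - real (10 * j)" "exp (- 36 * real j / q) \<le> 1 / 9"
    and q: "134 \<le> q"
  shows "card V \<le> 10 * balanced_upper_chromatic_number V E + 9"
proof -
  define A where "A = (\<Union>t\<in>{..<10 * j}. ray t)"
  define B where "B = insert P (\<Union>t\<in>{10 * j..q}. ray t)"
  define N where "N = ((q + 1 - 10 * j) * q + 1) div 10"
  have "10 \<le> q" using q by simp
  from exists_head_coloring[OF j(1) this, folded A_def]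
  obtain h1 :: "'a \<Rightarrow> nat \<times> nat" and U where
    h1: "h1 ` A \<subseteq> {..<j} \<times> {..<q}" "\<forall>c\<in>{..<j} \<times> {..<q}. card {x \<in> A. h1 x = c} = 10"
    and U: "U \<subseteq> {l \<in> E. P \<notin> l}" "real (card U) \<le> (real q)\<^sup>2 * exp (- 36 * real j / q)"
    and pairs1: "\<forall>l\<in>({l \<in> E. P \<notin> l} - U) \<union> g ` {..<10 * j}.
      \<exists>x\<in>l \<inter> A. \<exists>y\<in>l \<inter> A. x \<noteq> y \<and> h1 x = h1 y"
    by (elim exE conjE) (rule that)
  have "(real q)\<^sup>2 * exp (- 36 * real j / q) \<le> (real q)\<^sup>2 * (1 / 9)"
    using j(3) by (intro mult_left_mono) auto
  then have small: "real (card U) \<le> (real q)\<^sup>2 / 9" using U(2) by simp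
  have "\<exists>h. h ` B \<subseteq> {..<N} \<and> (\<forall>c<N. card {x \<in> B. h x = c} \<in> {10, 11}) \<and>
    (\<forall>l\<in>U \<union> g ` {10 * j..q}. \<exists>x\<in>l \<inter> B. \<exists>y\<in>l \<inter> B. x \<noteq> y \<and> h x = h y)"
    unfolding B_def N_def by (rule exists_tail_coloring[OF U(1) small j(1,2) q])
  then obtain h2 where
    h2: "h2 ` B \<subseteq> {..<N}" "\<forall>c<N. card {x \<in> B. h2 x = c} \<in> {10, 11}"
    and pairs2: "\<forall>l\<in>U \<union> g ` {10 * j..q}. \<exists>x\<in>l \<inter> B. \<exists>y\<in>l \<inter> B. x \<noteq> y \<and> h2 x = h2 y"
    by (elim exE conjE) (rule that)
  have disj: "x \<notin> A" if "x \<in> B" for x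
  proof
    assume "x \<in> A"
    then obtain t where t: "t < 10 * j" "x \<in> ray t" by (auto simp: A_def)
    then have "x \<noteq> P" by (auto simp: ray_def)
    then obtain u where u: "10 * j \<le> u" "u \<le> q" "x \<in> ray u"
      using \<open>x \<in> B\<close> by (auto simp: B_def)
    have "ray t \<inter> ray u = {}" using t(1) u by (intro ray_disjoint) auto
    then show False using t(2) u(3) by blast
  qed
  have "{..q} = {..<10 * j} \<union> {10 * j..q}" using j(1) by auto
  then have "V - {P} = A \<union> (\<Union>t\<in>{10 * j..q}. ray t)"
    unfolding UN_rays[symmetric] A_def by (simp only: UN_Un)
  then have V: "V = A \<union> B" unfolding B_def using centre by blast
  \<comment> \<open>The first component \<open>j\<close> is not a batch number, so the two palettes
    are disjoint.\<close>
  define f where "f x = (if x \<in> A then h1 x else (j, h2 x))" for x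
  define K where "K = {..<j} \<times> {..<q} \<union> {j} \<times> {..<N}"
  have h1j: "fst (h1 x) < j" "snd (h1 x) < q" if "x \<in> A" for x
    using h1(1) that by (auto simp: image_subset_iff mem_Times_iff)
  have fA: "f x = h1 x" if "x \<in> A" for x using that by (simp add: f_def)
  have fB: "f x = (j, h2 x)" if "x \<in> B" for x using disj[OF that] by (simp add: f_def)
  have fib1: "{x \<in> V. f x = c} = {x \<in> A. h1 x = c}" if c: "fst c < j" for c
  proof -
    have "f x \<noteq> c" if "x \<in> B" for x using fB[OF that] c by auto
    then show ?thesis using fA by (auto simp: V)
  qed
  have fib2: "{x \<in> V. f x = (j, c)} = {x \<in> B. h2 x = c}" for c
  proof -
    have "f x \<noteq> (j, c)" if "x \<in> A" for x using h1j(1)[OF that] fA[OF that] by auto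
    then show ?thesis using fB by (auto simp: V)
  qed
  have sizes: "card {x \<in> V. f x = c} \<in> {10, Suc 10}" if "c \<in> K" for c
    using that unfolding K_def
  proof
    assume c: "c \<in> {..<j} \<times> {..<q}"
    then have "fst c < j" by auto
    then show ?thesis using bspec[OF h1(2) c] fib1 by simp
  next
    assume "c \<in> {j} \<times> {..<N}"
    then obtain c' where "c = (j, c')" "c' < N" by auto
    then show ?thesis using h2(2) fib2 by simp
  qed
  have "f ` V = K"
  proof
    have "f x \<in> K" if "x \<in> A" for x
      using h1j[OF that] that by (simp add: f_def K_def mem_Times_iff)
    moreover have "f x \<in> K" if "x \<in> B" for x
      using h2(1) that by (auto simp: fB[OF that] K_def)
    ultimately show "f ` V \<subseteq> K" by (auto simp: V)
    show "K \<subseteq> f ` V"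
    proof
      fix c assume "c \<in> K"
      \<comment> \<open>Every color occurs because all prescribed class sizes are positive.\<close>
      then have "card {x \<in> V. f x = c} \<noteq> 0" using sizes[of c] by auto
      then have "{x \<in> V. f x = c} \<noteq> {}" by (metis card.empty)
      then show "c \<in> f ` V" by auto
    qed
  qed
  moreover have "\<exists>x\<in>l. \<exists>y\<in>l. x \<noteq> y \<and> f x = f y" if lE: "l \<in> E" for l
  proof (cases "l \<in> ({l \<in> E. P \<notin> l} - U) \<union> g ` {..<10 * j}")
    case True
    from bspec[OF pairs1 this] obtain x y where "x \<in> l \<inter> A" "y \<in> l \<inter> A" "x \<noteq> y" "h1 x = h1 y"
      by blast
    then show ?thesis by (intro bexI[of _ x] bexI[of _ y]) (auto simp: f_def)
  next
    case False
    have "l \<in> U \<union> g ` {10 * j..q}"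
    proof (cases "P \<in> l")
      case True
      then obtain t where "t \<le> q" "l = g t" using enumeration lE by (auto simp: bij_betw_def)
      then show ?thesis using False by (cases "t < 10 * j") auto
    qed (use False lE in auto)
    from bspec[OF pairs2 this] obtain x y where
      "x \<in> l \<inter> B" "y \<in> l \<inter> B" "x \<noteq> y" "h2 x = h2 y" by blast
    then show ?thesis by (intro bexI[of _ x] bexI[of _ y]) (auto simp: fB)
  qed
  ultimately have "card K \<le> balanced_upper_chromatic_number V E"
    using sizes by (intro balanced_upper_chromatic_number_ge[of f K 10]) auto
  moreover have "card K = j * q + N"
    unfolding K_def by (subst card_Un_disjoint) (auto simp: card_cartesian_product)
  moreover have "card V \<le> 10 * (j * q + N) + 9"
  proof -
    have "(q + 1 - 10 * j) * q + 10 * j * q = (q + 1) * q"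
      using j(1) by (simp flip: add_mult_distrib)
    then have "card V = 10 * (j * q) + ((q + 1 - 10 * j) * q + 1)"
      unfolding card_V by (simp add: power2_eq_square)
    moreover have "(q + 1 - 10 * j) * q + 1 \<le> 10 * N + 9"
      unfolding N_def using div_mult_mod_eq[of "(q + 1 - 10 * j) * q + 1" 10] by (simp del: div_mult_mod_eq)
    ultimately show ?thesis by simp
  qed
  ultimately have "j * q + N \<le> balanced_upper_chromatic_number V E"
    and V_le: "card V \<le> 10 * (j * q + N) + 9" by simp_all
  then have "10 * (j * q + N) + 9 \<le> 10 * balanced_upper_chromatic_number V E + 9"
    by (intro add_mono mult_le_mono2) simp_all
  with V_le show ?thesis by (rule order_trans)
qed

end

section \<open>Numerical choice of the number of batches and conclusion\<close>

lemma exp_ge_9: "9 \<le> exp (9 / 4 :: real)"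
proof -
  \<comment> \<open>The power is 1.045 to the 50th, about 9.03.\<close>
  have "(9 :: real) \<le> (1 + 9 / 4 / of_nat 50) ^ 50" by (simp add: power_divide)
  also have "\<dots> \<le> exp (9 / 4)" by (rule exp_ge_one_plus_x_over_n_power_n) auto
  finally show ?thesis .
qed

theorem theorem4:
  fixes V :: "'a set" and E :: "'a set set" and q :: nat
  assumes "projective_plane_of_order V E q" and "q > 133"
  shows "real (balanced_upper_chromatic_number V E) \<ge> ((real q)^2 + real q - 16) / 10"
proof -
  interpret projective_plane_of_order V E q by (rule assms(1))
  obtain Q where "Q \<subseteq> V" "card Q = 4" using quadrangle by blast
  then have "Q \<noteq> {}" by auto
  then obtain P where P: "P \<in> V" using \<open>Q \<subseteq> V\<close> by blast
  have "finite {l \<in> E. P \<in> l}" using finite_lines by simp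
  from ex_bij_betw_finite_nat[OF this] obtain e where
    e: "bij_betw e {l \<in> E. P \<in> l} {..q}"
    by (auto simp: card_pencil[OF P] atLeast0LessThan lessThan_Suc_atMost)
  interpret enumerated_pencil V E q P "inv_into {l \<in> E. P \<in> l} e"
    using P bij_betw_inv_into[OF e] assms(2) by unfold_locales auto
  \<comment> \<open>The largest number of batches that leaves \<open>3 * q / 10\<close> in the tail
    estimate. The rainbow bound asks for \<open>36 * j \<ge> 9 * q / 4\<close>; rounding down costs
    at most 99/100 of a batch, which is affordable from \<open>q = 132\<close> on.\<close>
  define j where "j = 7 * q div 100"
  have j1: "100 * j \<le> 7 * q" and j2: "7 * q \<le> 100 * j + 99" unfolding j_def by auto
  have "7 * real q \<le> 100 * real j + 99" using j2 by linarith
  moreover have "134 \<le> real q" using assms(2) by linarith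
  ultimately have "9 / 4 * real q \<le> 36 * real j" by linarith
  then have "9 / 4 \<le> 36 * real j / q" using assms(2) by (simp add: field_simps)
  then have "9 \<le> exp (36 * real j / q)" using exp_ge_9 by (meson exp_le_cancel_iff order_trans)
  then have "exp (- 36 * real j / q) \<le> 1 / 9"
    by (simp add: exp_minus field_simps)
  then have "card V \<le> 10 * balanced_upper_chromatic_number V E + 9"
    using j1 assms(2) by (intro card_V_le_balanced_upper_chromatic_number[of j]) linarith+
  then have "q\<^sup>2 + q + 1 \<le> 10 * balanced_upper_chromatic_number V E + 9"
    by (simp add: card_V)
  then have "real (q\<^sup>2 + q + 1) \<le> real (10 * balanced_upper_chromatic_number V E + 9)"
    by (rule of_nat_mono)
  then show ?thesis by simp
qed

end
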